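(* Let $S_1,\ldots,S_n$ be comaximal monoids of a commutative ring $R$ and let $\mathcal{C}$ be an idealistic chain of $R$. Then $\mathcal{C}$ collapses in $R$ if and only if (its image) collapses in each of the localizations $R_{S_i}$. In particular the Krull dimension of $R$ is $\le\ell$ if and only if the Krull dimension of each of the $R_{S_i}$ is $\le\ell$.
   Context: All monoids are multiplicative submonoids of the ring. Monoids $S_1,\ldots,S_n$ of $R$ are comaximal if every ideal of $R$ that meets each $S_i$ contains $1$, i.e. for all $s_1\in S_1,\ldots,s_n\in S_n$ there exist $a_1,\ldots,a_n\in R$ with $\sum_i a_is_i=1$. For $J,U\subseteq R$, $\langle J\rangle$ is the ideal generated by $J$ and $\mathcal{M}(U)$ the multiplicative monoid (containing $1$) generated by $U$. An idealistic chain of length $k$ in $R$ is a list $((J_0,U_0),\ldots,(J_k,U_k))$ of $k+1$ pairs of subsets of $R$. It collapses in $R$ if there exist $j_i\in\langle J_i\rangle$, $u_i\in\mathcal{M}(U_i)$ $(i=0,\ldots,k)$ with $$u_0\cdot(u_1\cdot(\cdots(u_k+j_k)+\cdots)+j_1)+j_0=0.$$ It collapses in an $R$-algebra if the chain of images of the $J_i$, $U_i$ collapses in that algebra. Krull dimension: $R$ has dimension $\le -1$ iff $1=0$ in $R$; for $m\ge1$, $R$ has dimension $\le m-1$ iff for every sequence $(x_1,\ldots,x_m)$ in $R$ the elementary chain $((\{0\},\{x_1\}),(\{x_1\},\{x_2\}),\ldots,(\{x_{m-1}\},\{x_m\}),(\{x_m\},\{1\}))$ collapses, i.e. there exist $a_i\in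 R$, $m_i\in\mathbb{N}$ with $x_1^{m_1}(\cdots(x_m^{m_m}(1+a_mx_m)+\cdots)+a_1x_1)=0$. *)

theory Defs
  imports "HOL-Algebra.Algebra"
begin

section \<open>Localizations\<close>

text \<open>
  The relation identifying the fractions \<open>a/s\<close> and \<open>b/t\<close>. The multiplier \<open>u\<close> is needed
  because the monoid may contain zero divisors; it may even contain \<open>\<zero>\<close>, in which case the
  localization is the zero ring.
\<close>

definition frac_rel ::
    "('a, 'b) ring_scheme \<Rightarrow> 'a set \<Rightarrow> (('a \<times> 'a) \<times> ('a \<times> 'a)) set" where
  "frac_rel R S =
     {((a, s), (b, t)). a \<in> carrier R \<and> s \<in> S \<and> b \<in> carrier R \<and> t \<in> S \<and>
        (\<exists>u\<in>S. u \<otimes>\<^bsub>R\<^esub> (t \<otimes>\<^bsub>R\<^esub> a \<ominus>\<^bsub>R\<^esub> s \<otimes>\<^bsub>R\<^esub> b) = \<zero>\<^bsub>R\<^esub>)}"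

definition loc_frac :: "('a, 'b) ring_scheme \<Rightarrow> 'a set \<Rightarrow> 'a \<Rightarrow> 'a \<Rightarrow> ('a \<times> 'a) set" where
  "loc_frac R S a s = frac_rel R S `` {(a, s)}"

definition localization :: "('a, 'b) ring_scheme \<Rightarrow> 'a set \<Rightarrow> ('a \<times> 'a) set ring" where
  "localization R S =
     \<lparr>carrier = (carrier R \<times> S) // frac_rel R S,
      monoid.mult = (\<lambda>P Q. \<Union>(a, s)\<in>P. \<Union>(b, t)\<in>Q.
         loc_frac R S (a \<otimes>\<^bsub>R\<^esub> b) (s \<otimes>\<^bsub>R\<^esub> t)),
      monoid.one = loc_frac R S \<one>\<^bsub>R\<^esub> \<one>\<^bsub>R\<^esub>,
      ring.zero = loc_frac R S \<zero>\<^bsub>R\<^esub> \<one>\<^bsub>R\<^esub>,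
      ring.add = (\<lambda>P Q. \<Union>(a, s)\<in>P. \<Union>(b, t)\<in>Q.
         loc_frac R S (a \<otimes>\<^bsub>R\<^esub> t \<oplus>\<^bsub>R\<^esub> b \<otimes>\<^bsub>R\<^esub> s) (s \<otimes>\<^bsub>R\<^esub> t))\<rparr>"

definition loc_map :: "('a, 'b) ring_scheme \<Rightarrow> 'a set \<Rightarrow> 'a \<Rightarrow> ('a \<times> 'a) set" where
  "loc_map R S a = loc_frac R S a \<one>\<^bsub>R\<^esub>"

locale cring_submonoid = cring R + submonoid S R for R (structure) and S
begin

lemma S_carrier [simp]: "s \<in> S \<Longrightarrow> s \<in> carrier R"
  using subset by blast

lemma frac_rel_equiv: "equiv (carrier R \<times> S) (frac_rel R S)"
proof (rule equivI)
  show "frac_rel R S \<subseteq> (carrier R \<times> S) \<times> (carrier R \<times> S)"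
    by (auto simp: frac_rel_def)
  show "refl_on (carrier R \<times> S) (frac_rel R S)"
    by (auto simp: refl_on_def frac_rel_def r_right_minus_eq intro!: bexI[of _ \<one>])
  show "sym (frac_rel R S)"
  proof (rule symI, clarsimp simp: frac_rel_def)
    fix a s b t u
    assume *: "a \<in> carrier R" "s \<in> S" "b \<in> carrier R" "t \<in> S" "u \<in> S"
      "u \<otimes> (t \<otimes> a \<ominus> s \<otimes> b) = \<zero>"
    then have c: "s \<in> carrier R" "t \<in> carrier R" "u \<in> carrier R" by simp_all
    have "u \<otimes> (s \<otimes> b \<ominus> t \<otimes> a) = \<ominus> (u \<otimes> (t \<otimes> a \<ominus> s \<otimes> b))"
      using *(1,3) c by algebra
    then show "\<exists>u\<in>S. u \<otimes> (s \<otimes> b \<ominus> t \<otimes> a) = \<zero>" using * by auto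
  qed
  show "trans (frac_rel R S)"
  proof (rule transI, clarsimp simp: frac_rel_def)
    fix a s b t c r u v
    assume *: "a \<in> carrier R" "s \<in> S" "b \<in> carrier R" "t \<in> S" "c \<in> carrier R" "r \<in> S"
      "u \<in> S" "v \<in> S" "u \<otimes> (t \<otimes> a \<ominus> s \<otimes> b) = \<zero>" "v \<otimes> (r \<otimes> b \<ominus> t \<otimes> c) = \<zero>"
    then have c: "s \<in> carrier R" "t \<in> carrier R" "r \<in> carrier R" "u \<in> carrier R" "v \<in> carrier R"
      by simp_all
    have "(u \<otimes> v \<otimes> t) \<otimes> (r \<otimes> a \<ominus> s \<otimes> c) =
       v \<otimes> r \<otimes> (u \<otimes> (t \<otimes> a \<ominus> s \<otimes> b)) \<oplus> u \<otimes> s \<otimes> (v \<otimes> (r \<otimes> b \<ominus> t \<otimes> c))"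
      using *(1,3,5) c by algebra
    also have "\<dots> = \<zero>" using * c by simp
    finally show "\<exists>u\<in>S. u \<otimes> (r \<otimes> a \<ominus> s \<otimes> c) = \<zero>"
      using * by (intro bexI[of _ "u \<otimes> v \<otimes> t"]) auto
  qed
qed

lemma frac_eq_iff:
  assumes "a \<in> carrier R" "s \<in> S" "b \<in> carrier R" "t \<in> S"
  shows "loc_frac R S a s = loc_frac R S b t \<longleftrightarrow> (\<exists>u\<in>S. u \<otimes> (t \<otimes> a \<ominus> s \<otimes> b) = \<zero>)"
  unfolding loc_frac_def
  using eq_equiv_class_iff[OF frac_rel_equiv, of "(a, s)" "(b, t)"] assms
  by (auto simp: frac_rel_def)

lemma carrier_localization:
  "carrier (localization R S) = {loc_frac R S a s | a s. a \<in> carrier R \<and> s \<in> S}"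
  by (auto simp: localization_def quotient_def loc_frac_def)

lemma frac_closed:
  "a \<in> carrier R \<Longrightarrow> s \<in> S \<Longrightarrow> loc_frac R S a s \<in> carrier (localization R S)"
  by (auto simp: carrier_localization)

lemma frac_mult:
  assumes "a \<in> carrier R" "s \<in> S" "b \<in> carrier R" "t \<in> S"
  shows "loc_frac R S a s \<otimes>\<^bsub>localization R S\<^esub> loc_frac R S b t = loc_frac R S (a \<otimes> b) (s \<otimes> t)"
proof -
  have "congruent2 (frac_rel R S) (frac_rel R S)
          (\<lambda>p q. case p of (a, s) \<Rightarrow> case q of (b, t) \<Rightarrow> loc_frac R S (a \<otimes> b) (s \<otimes> t))"
  proof (rule congruent2I', clarsimp simp: frac_rel_def, subst frac_eq_iff; (intro m_closed)?)
    fix a s a' s' u b t b' t' v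
    assume *: "a \<in> carrier R" "s \<in> S" "a' \<in> carrier R" "s' \<in> S" "u \<in> S"
      "u \<otimes> (s' \<otimes> a \<ominus> s \<otimes> a') = \<zero>"
      "b \<in> carrier R" "t \<in> S" "b' \<in> carrier R" "t' \<in> S" "v \<in> S"
      "v \<otimes> (t' \<otimes> b \<ominus> t \<otimes> b') = \<zero>"
    then have c: "s \<in> carrier R" "t \<in> carrier R" "s' \<in> carrier R" "t' \<in> carrier R"
      "u \<in> carrier R" "v \<in> carrier R"
      by simp_all
    have "(u \<otimes> v) \<otimes> (s' \<otimes> t' \<otimes> (a \<otimes> b) \<ominus> s \<otimes> t \<otimes> (a' \<otimes> b')) =
       v \<otimes> t' \<otimes> b \<otimes> (u \<otimes> (s' \<otimes> a \<ominus> s \<otimes> a')) \<oplus> u \<otimes> s \<otimes> a' \<otimes> (v \<otimes> (t' \<otimes> b \<ominus> t \<otimes> b'))"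
      using *(1,3,7,9) c by algebra
    also have "\<dots> = \<zero>" using * c by simp
    finally show "\<exists>u\<in>S. u \<otimes> (s' \<otimes> t' \<otimes> (a \<otimes> b) \<ominus> s \<otimes> t \<otimes> (a' \<otimes> b')) = \<zero>"
      using * by (intro bexI[of _ "u \<otimes> v"]) auto
  qed simp_all
  from UN_equiv_class2[OF frac_rel_equiv frac_rel_equiv this, of "(a, s)" "(b, t)"] assms
  show ?thesis
    by (simp add: localization_def loc_frac_def[of R S a s] loc_frac_def[of R S b t] split_def)
qed

lemma frac_add:
  assumes "a \<in> carrier R" "s \<in> S" "b \<in> carrier R" "t \<in> S"
  shows "loc_frac R S a s \<oplus>\<^bsub>localization R S\<^esub> loc_frac R S b t
           = loc_frac R S (a \<otimes> t \<oplus> b \<otimes> s) (s \<otimes> t)"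
proof -
  have "congruent2 (frac_rel R S) (frac_rel R S)
          (\<lambda>p q. case p of (a, s) \<Rightarrow> case q of (b, t) \<Rightarrow>
             loc_frac R S (a \<otimes> t \<oplus> b \<otimes> s) (s \<otimes> t))"
  proof (rule congruent2I', clarsimp simp: frac_rel_def, subst frac_eq_iff;
         (intro add.m_closed m_closed)?)
    fix a s a' s' u b t b' t' v
    assume *: "a \<in> carrier R" "s \<in> S" "a' \<in> carrier R" "s' \<in> S" "u \<in> S"
      "u \<otimes> (s' \<otimes> a \<ominus> s \<otimes> a') = \<zero>"
      "b \<in> carrier R" "t \<in> S" "b' \<in> carrier R" "t' \<in> S" "v \<in> S"
      "v \<otimes> (t' \<otimes> b \<ominus> t \<otimes> b') = \<zero>"
    then have c: "s \<in> carrier R" "t \<in> carrier R" "s' \<in> carrier R" "t' \<in> carrier R"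
      "u \<in> carrier R" "v \<in> carrier R"
      by simp_all
    have "(u \<otimes> v) \<otimes> (s' \<otimes> t' \<otimes> (a \<otimes> t \<oplus> b \<otimes> s) \<ominus> s \<otimes> t \<otimes> (a' \<otimes> t' \<oplus> b' \<otimes> s')) =
       v \<otimes> t \<otimes> t' \<otimes> (u \<otimes> (s' \<otimes> a \<ominus> s \<otimes> a')) \<oplus> u \<otimes> s \<otimes> s' \<otimes> (v \<otimes> (t' \<otimes> b \<ominus> t \<otimes> b'))"
      using *(1,3,7,9) c by algebra
    also have "\<dots> = \<zero>" using * c by simp
    finally show "\<exists>u\<in>S. u \<otimes> (s' \<otimes> t' \<otimes> (a \<otimes> t \<oplus> b \<otimes> s) \<ominus> s \<otimes> t \<otimes> (a' \<otimes> t' \<oplus> b' \<otimes> s')) = \<zero>"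
      using * by (intro bexI[of _ "u \<otimes> v"]) auto
  qed simp_all
  from UN_equiv_class2[OF frac_rel_equiv frac_rel_equiv this, of "(a, s)" "(b, t)"] assms
  show ?thesis
    by (simp add: localization_def loc_frac_def[of R S a s] loc_frac_def[of R S b t] split_def)
qed

lemma frac_eqI:
  assumes "a \<in> carrier R" "s \<in> S" "b \<in> carrier R" "t \<in> S" "t \<otimes> a = s \<otimes> b"
  shows "loc_frac R S a s = loc_frac R S b t"
  using assms by (auto simp: frac_eq_iff r_right_minus_eq intro!: bexI[of _ \<one>])

lemma one_localization: "\<one>\<^bsub>localization R S\<^esub> = loc_frac R S \<one> \<one>"
  and zero_localization: "\<zero>\<^bsub>localization R S\<^esub> = loc_frac R S \<zero> \<one>"
  by (simp_all add: localization_def)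

lemma cring_localization: "cring (localization R S)"
proof (rule cringI[OF abelian_groupI comm_monoidI])
  let ?L = "localization R S"
  note sims = carrier_localization one_localization zero_localization frac_add frac_mult
  show "x \<oplus>\<^bsub>?L\<^esub> y \<in> carrier ?L" if "x \<in> carrier ?L" "y \<in> carrier ?L" for x y
    using that by (force simp: sims)
  show "\<zero>\<^bsub>?L\<^esub> \<in> carrier ?L" "\<one>\<^bsub>?L\<^esub> \<in> carrier ?L"
    by (force simp: sims)+
  show "x \<otimes>\<^bsub>?L\<^esub> y \<in> carrier ?L" if "x \<in> carrier ?L" "y \<in> carrier ?L" for x y
    using that by (force simp: sims)
  fix x assume x: "x \<in> carrier ?L"
  then obtain a s where as: "x = loc_frac R S a s" "a \<in> carrier R" "s \<in> S" "s \<in> carrier R"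
    by (force simp: sims)
  show "\<zero>\<^bsub>?L\<^esub> \<oplus>\<^bsub>?L\<^esub> x = x" "\<one>\<^bsub>?L\<^esub> \<otimes>\<^bsub>?L\<^esub> x = x"
    using as by (simp_all add: sims)
  have "loc_frac R S (\<ominus> a) s \<oplus>\<^bsub>?L\<^esub> x = loc_frac R S \<zero> (s \<otimes> s)"
    using as by (simp add: frac_add l_minus l_neg)
  also have "\<dots> = \<zero>\<^bsub>?L\<^esub>"
    unfolding zero_localization using as by (intro frac_eqI) simp_all
  finally show "\<exists>y\<in>carrier ?L. y \<oplus>\<^bsub>?L\<^esub> x = \<zero>\<^bsub>?L\<^esub>"
    using frac_closed[of "\<ominus> a" s] as by blast
  fix y assume y: "y \<in> carrier ?L"
  then obtain b t where bt: "y = loc_frac R S b t" "b \<in> carrier R" "t \<in> S" "t \<in> carrier R"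
    by (force simp: sims)
  show "x \<oplus>\<^bsub>?L\<^esub> y = y \<oplus>\<^bsub>?L\<^esub> x" "x \<otimes>\<^bsub>?L\<^esub> y = y \<otimes>\<^bsub>?L\<^esub> x"
    using as bt by (simp_all add: sims a_comm m_comm)
  fix z assume z: "z \<in> carrier ?L"
  then obtain c r where cr: "z = loc_frac R S c r" "c \<in> carrier R" "r \<in> S" "r \<in> carrier R"
    by (force simp: sims)
  note cs = as(2,4) bt(2,4) cr(2,4)
  have "(a \<otimes> t \<oplus> b \<otimes> s) \<otimes> r \<oplus> c \<otimes> (s \<otimes> t) = a \<otimes> (t \<otimes> r) \<oplus> (b \<otimes> r \<oplus> c \<otimes> t) \<otimes> s"
    using cs by algebra
  then show "x \<oplus>\<^bsub>?L\<^esub> y \<oplus>\<^bsub>?L\<^esub> z = x \<oplus>\<^bsub>?L\<^esub> (y \<oplus>\<^bsub>?L\<^esub> z)"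
    using as bt cr by (simp add: sims m_assoc)
  show "x \<otimes>\<^bsub>?L\<^esub> y \<otimes>\<^bsub>?L\<^esub> z = x \<otimes>\<^bsub>?L\<^esub> (y \<otimes>\<^bsub>?L\<^esub> z)"
    using as bt cr by (simp add: sims m_assoc)
  have "((s \<otimes> r) \<otimes> (t \<otimes> r)) \<otimes> ((a \<otimes> t \<oplus> b \<otimes> s) \<otimes> c)
      = ((s \<otimes> t) \<otimes> r) \<otimes> ((a \<otimes> c) \<otimes> (t \<otimes> r) \<oplus> (b \<otimes> c) \<otimes> (s \<otimes> r))"
    using cs by algebra
  then show "(x \<oplus>\<^bsub>?L\<^esub> y) \<otimes>\<^bsub>?L\<^esub> z = x \<otimes>\<^bsub>?L\<^esub> z \<oplus>\<^bsub>?L\<^esub> y \<otimes>\<^bsub>?L\<^esub> z"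
    unfolding as(1) bt(1) cr(1) using as bt cr
    by (simp add: frac_add frac_mult) (rule frac_eqI; simp)
qed

lemma loc_map_ring_hom: "loc_map R S \<in> ring_hom R (localization R S)"
  by (rule ring_hom_memI)
    (simp_all add: loc_map_def frac_closed frac_add frac_mult one_localization)

lemma loc_map_Units:
  assumes "s \<in> S"
  shows "loc_map R S s \<in> Units (localization R S)"
proof -
  interpret L: cring "localization R S" by (rule cring_localization)
  have "loc_frac R S \<one> s \<otimes>\<^bsub>localization R S\<^esub> loc_map R S s = loc_frac R S s s"
    using assms by (simp add: loc_map_def frac_mult)
  also have "\<dots> = \<one>\<^bsub>localization R S\<^esub>"
    unfolding one_localization using assms by (intro frac_eqI) simp_all
  finally show ?thesis
    using assms frac_closed[of \<one> s] frac_closed[of s \<one>] L.unit_factor[of _ "loc_map R S s"]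
      L.Units_one_closed L.m_comm
    unfolding loc_map_def by (metis L.unit_factor one_closed S_carrier)
qed

end


section \<open>Comaximal monoids\<close>

definition comaximal :: "('a, 'b) ring_scheme \<Rightarrow> nat \<Rightarrow> (nat \<Rightarrow> 'a set) \<Rightarrow> bool" where
  "comaximal R n S \<longleftrightarrow>
     (\<forall>I. ideal I R \<longrightarrow> (\<forall>i\<in>{1..n}. I \<inter> S i \<noteq> {}) \<longrightarrow> \<one>\<^bsub>R\<^esub> \<in> I)"

lemma (in cring) comaximal_iff_finsum:
  assumes S: "\<And>i. i \<in> {1..n} \<Longrightarrow> S i \<subseteq> carrier R"
  shows "comaximal R n S \<longleftrightarrow>
    (\<forall>s. (\<forall>i\<in>{1..n}. s i \<in> S i) \<longrightarrow>
      (\<exists>a. a \<in> {1..n} \<rightarrow> carrier R \<and> (\<Oplus>i\<in>{1..n}. a i \<otimes> s i) = \<one>))"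
proof (intro iffI allI impI)
  fix s assume co: "comaximal R n S" and s: "\<forall>i\<in>{1..n}. s i \<in> S i"
  have sc: "s i \<in> carrier R" if "i \<in> {1..n}" for i
    using S s that by blast
  define I where "I = {\<Oplus>i\<in>{1..n}. a i \<otimes> s i | a. a \<in> {1..n} \<rightarrow> carrier R}"
  have fin: "(\<Oplus>i\<in>{1..n}. a i \<otimes> s i) \<in> carrier R" if "a \<in> {1..n} \<rightarrow> carrier R" for a
    using that sc by (intro finsum_closed) (auto simp: Pi_iff)
  have memI: "(\<Oplus>i\<in>{1..n}. a i \<otimes> s i) \<in> I" if "a \<in> {1..n} \<rightarrow> carrier R" for a
    using that unfolding I_def by blast
  have scal: "x \<otimes> (\<Oplus>i\<in>{1..n}. a i \<otimes> s i) = (\<Oplus>i\<in>{1..n}. (x \<otimes> a i) \<otimes> s i)"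
    if "x \<in> carrier R" "a \<in> {1..n} \<rightarrow> carrier R" for x a
  proof -
    have "x \<otimes> (\<Oplus>i\<in>{1..n}. a i \<otimes> s i) = (\<Oplus>i\<in>{1..n}. x \<otimes> (a i \<otimes> s i))"
      using that sc by (intro finsum_rdistr) (auto simp: Pi_iff)
    also have "\<dots> = (\<Oplus>i\<in>{1..n}. (x \<otimes> a i) \<otimes> s i)"
      using that sc by (intro finsum_cong') (auto simp: Pi_iff m_assoc)
    finally show ?thesis .
  qed
  have closed: "x \<otimes> p \<in> I" if "x \<in> carrier R" "p \<in> I" for x p
  proof -
    from \<open>p \<in> I\<close> obtain a where a: "a \<in> {1..n} \<rightarrow> carrier R" "p = (\<Oplus>i\<in>{1..n}. a i \<otimes> s i)"
      unfolding I_def by blast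
    have "(\<lambda>i. x \<otimes> a i) \<in> {1..n} \<rightarrow> carrier R"
      using a(1) that(1) by (auto simp: Pi_iff)
    from memI[OF this] scal[OF that(1) a(1)] a(2) show ?thesis by simp
  qed
  have sub: "I \<subseteq> carrier R" using fin by (auto simp: I_def)
  have add: "p \<oplus> q \<in> I" if pq: "p \<in> I" "q \<in> I" for p q
  proof -
    from pq obtain a b where ab: "a \<in> {1..n} \<rightarrow> carrier R" "p = (\<Oplus>i\<in>{1..n}. a i \<otimes> s i)"
      "b \<in> {1..n} \<rightarrow> carrier R" "q = (\<Oplus>i\<in>{1..n}. b i \<otimes> s i)"
      unfolding I_def by blast
    have "p \<oplus> q = (\<Oplus>i\<in>{1..n}. a i \<otimes> s i \<oplus> b i \<otimes> s i)"
      unfolding ab(2,4) using ab(1,3) sc by (intro finsum_addf[symmetric]) (auto simp: Pi_iff)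
    also have "\<dots> = (\<Oplus>i\<in>{1..n}. (a i \<oplus> b i) \<otimes> s i)"
      using ab(1,3) sc by (intro finsum_cong') (auto simp: Pi_iff l_distr)
    finally have "p \<oplus> q = (\<Oplus>i\<in>{1..n}. (a i \<oplus> b i) \<otimes> s i)" .
    moreover have "(\<lambda>i. a i \<oplus> b i) \<in> {1..n} \<rightarrow> carrier R"
      using ab(1,3) by (auto simp: Pi_iff)
    ultimately show ?thesis using memI[of "\<lambda>i. a i \<oplus> b i"] by simp
  qed
  have gen: "s i \<in> I" if i: "i \<in> {1..n}" for i
  proof -
    have "(\<Oplus>k\<in>{1..n}. (if i = k then \<one> else \<zero>) \<otimes> s k) = (\<Oplus>k\<in>{1..n}. if i = k then s k else \<zero>)"
      using sc by (intro finsum_cong') auto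
    also have "\<dots> = s i"
      using i sc by (intro add.finprod_singleton) auto
    finally show ?thesis
      using memI[of "\<lambda>k. if i = k then \<one> else \<zero>"] by (auto simp: Pi_iff)
  qed
  have zero: "\<zero> \<in> I"
  proof -
    have "(\<Oplus>i\<in>{1..n}. \<zero> \<otimes> s i) = (\<Oplus>i\<in>{1..n}. \<zero>)"
      using sc by (intro finsum_cong') auto
    then have "(\<Oplus>i\<in>{1..n}. \<zero> \<otimes> s i) = \<zero>" by simp
    then show ?thesis using memI[of "\<lambda>_. \<zero>"] by simp
  qed
  have "ideal I R"
  proof (rule idealI)
    show "subgroup I (add_monoid R)"
    proof (rule add.subgroupI)
      show "\<ominus> p \<in> I" if "p \<in> I" for p
        using closed[of "\<ominus> \<one>" p] that sub by (auto simp: l_minus)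
    qed (use sub add zero in auto)
    show "p \<otimes> x \<in> I" if "p \<in> I" "x \<in> carrier R" for p x
      using closed[OF that(2,1)] that sub m_comm by auto
  qed (use closed ring_axioms in auto)
  then have "\<one> \<in> I"
    using co gen s unfolding comaximal_def by blast
  then obtain a where "a \<in> {1..n} \<rightarrow> carrier R" "\<one> = (\<Oplus>i\<in>{1..n}. a i \<otimes> s i)"
    unfolding I_def by blast
  then show "\<exists>a. a \<in> {1..n} \<rightarrow> carrier R \<and> (\<Oplus>i\<in>{1..n}. a i \<otimes> s i) = \<one>"
    by metis
next
  assume R: "\<forall>s. (\<forall>i\<in>{1..n}. s i \<in> S i) \<longrightarrow>
      (\<exists>a. a \<in> {1..n} \<rightarrow> carrier R \<and> (\<Oplus>i\<in>{1..n}. a i \<otimes> s i) = \<one>)"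
  show "comaximal R n S"
    unfolding comaximal_def
  proof (intro allI impI)
    fix I assume I: "ideal I R" and "\<forall>i\<in>{1..n}. I \<inter> S i \<noteq> {}"
    then have "\<forall>i\<in>{1..n}. \<exists>x. x \<in> I \<inter> S i" by blast
    then obtain s where s: "\<forall>i\<in>{1..n}. s i \<in> I \<inter> S i" by metis
    with R obtain a where a: "a \<in> {1..n} \<rightarrow> carrier R" "(\<Oplus>i\<in>{1..n}. a i \<otimes> s i) = \<one>"
      by blast
    interpret I: ideal I R by fact
    have "(\<Oplus>i\<in>A. a i \<otimes> s i) \<in> I" if "finite A" "A \<subseteq> {1..n}" for A
      using that
    proof (induction A rule: finite_induct)
      case empty
      show ?case by simp
    next
      case (insert k A)
      have mem: "a i \<otimes> s i \<in> I" if "i \<in> {1..n}" for i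
        using that a(1) s by (auto intro!: I.I_l_closed)
      then have "(\<Oplus>i\<in>insert k A. a i \<otimes> s i) = a k \<otimes> s k \<oplus> (\<Oplus>i\<in>A. a i \<otimes> s i)"
        using insert by (intro finsum_insert) (auto intro!: I.Icarr)
      then show ?case
        using insert mem by (auto intro!: I.a_closed)
    qed
    from this[of "{1..n}"] a(2) show "\<one> \<in> I" by simp
  qed
qed


section \<open>Idealistic chains\<close>

text \<open>The multiplicative monoid generated by a set, in analogy to \<^const>\<open>genideal\<close>.\<close>

definition genmonoid :: "('a, 'b) monoid_scheme \<Rightarrow> 'a set \<Rightarrow> 'a set" where
  "genmonoid G U = \<Inter>{H. submonoid H G \<and> U \<subseteq> H}"

text \<open>A chain \<open>((J\<^sub>0, U\<^sub>0), \<dots>, (J\<^sub>k, U\<^sub>k))\<close> of length \<open>k\<close> is a list with \<open>k + 1\<close> entries.\<close>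

type_synonym 'a idl_chain = "('a set \<times> 'a set) list"

definition idealistic_chain :: "('a, 'b) ring_scheme \<Rightarrow> 'a idl_chain \<Rightarrow> bool" where
  "idealistic_chain R C \<longleftrightarrow>
     C \<noteq> [] \<and> (\<forall>(J, U)\<in>set C. J \<subseteq> carrier R \<and> U \<subseteq> carrier R)"

text \<open>
  The value \<open>u\<^sub>0 (u\<^sub>1 (\<dots> (u\<^sub>k + j\<^sub>k) + \<dots>) + j\<^sub>1) + j\<^sub>0\<close> for the list
  \<open>((j\<^sub>0, u\<^sub>0), \<dots>, (j\<^sub>k, u\<^sub>k))\<close>; the value at the empty list is never used.
\<close>

fun nested_value :: "('a, 'b) ring_scheme \<Rightarrow> ('a \<times> 'a) list \<Rightarrow> 'a" where
  "nested_value R [] = \<one>\<^bsub>R\<^esub>"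
| "nested_value R [(j, u)] = u \<oplus>\<^bsub>R\<^esub> j"
| "nested_value R ((j, u) # p # ps) = u \<otimes>\<^bsub>R\<^esub> nested_value R (p # ps) \<oplus>\<^bsub>R\<^esub> j"

definition collapses :: "('a, 'b) ring_scheme \<Rightarrow> 'a idl_chain \<Rightarrow> bool" where
  "collapses R C \<longleftrightarrow>
     (\<exists>ps. list_all2 (\<lambda>(j, u) (J, U). j \<in> genideal R J \<and> u \<in> genmonoid R U) ps C \<and>
           nested_value R ps = \<zero>\<^bsub>R\<^esub>)"

definition image_chain :: "('a \<Rightarrow> 'b) \<Rightarrow> 'a idl_chain \<Rightarrow> 'b idl_chain" where
  "image_chain f C = map (\<lambda>(J, U). (f ` J, f ` U)) C"


section \<open>Krull dimension\<close>

text \<open>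
  For \<open>xs = [x\<^sub>1, \<dots>, x\<^sub>m]\<close> this is
  \<open>(({\<zero>}, {x\<^sub>1}), ({x\<^sub>1}, {x\<^sub>2}), \<dots>, ({x\<^sub>m}, {\<one>}))\<close>.
\<close>

definition elementary_chain :: "('a, 'b) ring_scheme \<Rightarrow> 'a list \<Rightarrow> 'a idl_chain" where
  "elementary_chain R xs = map2 (\<lambda>x y. ({x}, {y})) (\<zero>\<^bsub>R\<^esub> # xs) (xs @ [\<one>\<^bsub>R\<^esub>])"

text \<open>\<open>krull_dim_le R l\<close> is meant for \<open>l \<ge> -1\<close> only.\<close>

definition krull_dim_le :: "('a, 'b) ring_scheme \<Rightarrow> int \<Rightarrow> bool" where
  "krull_dim_le R l \<longleftrightarrow>
     (if l = -1 then \<one>\<^bsub>R\<^esub> = \<zero>\<^bsub>R\<^esub>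
      else \<forall>xs. int (length xs) = l + 1 \<and> set xs \<subseteq> carrier R
                  \<longrightarrow> collapses R (elementary_chain R xs))"

end

theory Submission
  imports Defs
begin

text \<open>
  Fix \<open>u\<^sub>i \<in> \<M>(U\<^sub>i)\<close>. The elements \<open>r\<close> for which
  \<open>u\<^sub>0 (u\<^sub>1 (\<dots> (u\<^sub>k r + j\<^sub>k) + \<dots>) + j\<^sub>1) + j\<^sub>0 = 0\<close> for some
  \<open>j\<^sub>i \<in> \<langle>J\<^sub>i\<rangle>\<close> form an ideal, which only grows when the \<open>u\<^sub>i\<close> are replaced by multiples.
  Clearing denominators, a collapse in \<open>R\<^sub>S\<close> means that this ideal meets \<open>S\<close> for a suitable
  choice of the \<open>u\<^sub>i\<close>. Multiplying the choices for \<open>S\<^sub>1, \<dots>, S\<^sub>n\<close> together gives one ideal that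
  meets every \<open>S\<^sub>i\<close>, hence contains \<open>1\<close>, and this is a collapse in \<open>R\<close>.

  For the Krull dimension of \<open>R\<^sub>S\<close>, every sequence in \<open>R\<^sub>S\<close> is, up to units, the image of a
  sequence in \<open>R\<close>, and rescaling by units does not affect the collapse of an elementary chain.
\<close>

section \<open>Generated monoids and ideals under homomorphisms\<close>

lemma genmonoid_incl: "U \<subseteq> genmonoid G U"
  by (auto simp: genmonoid_def)

lemma genmonoid_minimal: "submonoid H G \<Longrightarrow> U \<subseteq> H \<Longrightarrow> genmonoid G U \<subseteq> H"
  by (auto simp: genmonoid_def)

lemma (in monoid) submonoid_carrier: "submonoid (carrier G) G"
  by unfold_locales auto

lemma (in monoid) submonoid_genmonoid:
  assumes "U \<subseteq> carrier G"
  shows "submonoid (genmonoid G U) G"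
proof
  show "genmonoid G U \<subseteq> carrier G"
    using assms submonoid_carrier by (rule genmonoid_minimal[rotated])
qed (auto simp: genmonoid_def intro: submonoid.m_closed submonoid.one_closed)

text \<open>Both inclusions come from minimality of a generated monoid, once against an image
  submonoid and once against a preimage. Equality matters: it lets a multiplier in a localization be
  lifted to the ring exactly, without a denominator.\<close>

lemma genmonoid_hom_image:
  assumes "monoid G" "monoid H" "h \<in> hom G H" "h \<one>\<^bsub>G\<^esub> = \<one>\<^bsub>H\<^esub>" "U \<subseteq> carrier G"
  shows "genmonoid H (h ` U) = h ` genmonoid G U"
proof
  interpret G: monoid G by fact
  interpret H: monoid H by fact
  interpret M: submonoid "genmonoid G U" G
    by (rule G.submonoid_genmonoid) fact
  show "genmonoid H (h ` U) \<subseteq> h ` genmonoid G U"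
  proof (rule genmonoid_minimal)
    show "submonoid (h ` genmonoid G U) H"
    proof
      fix x y assume "x \<in> h ` genmonoid G U" "y \<in> h ` genmonoid G U"
      then obtain a b where ab: "a \<in> genmonoid G U" "b \<in> genmonoid G U" "x = h a" "y = h b"
        by blast
      then have "x \<otimes>\<^bsub>H\<^esub> y = h (a \<otimes>\<^bsub>G\<^esub> b)"
        using assms(3) M.subset by (auto simp: hom_def)
      then show "x \<otimes>\<^bsub>H\<^esub> y \<in> h ` genmonoid G U"
        using ab by auto
    next
      show "h ` genmonoid G U \<subseteq> carrier H"
        using assms(3) M.subset by (auto simp: hom_def)
      show "\<one>\<^bsub>H\<^esub> \<in> h ` genmonoid G U"
        using assms(4) M.one_closed by (metis imageI)
    qed
  qed (intro image_mono genmonoid_incl)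
  interpret N: submonoid "genmonoid H (h ` U)" H
    using assms(3,5) by (intro H.submonoid_genmonoid) (auto simp: hom_def)
  have "genmonoid G U \<subseteq> {a \<in> carrier G. h a \<in> genmonoid H (h ` U)}"
  proof (rule genmonoid_minimal)
    show "submonoid {a \<in> carrier G. h a \<in> genmonoid H (h ` U)} G"
      by unfold_locales (use assms(3,4) in \<open>auto simp: hom_def Pi_iff\<close>)
    show "U \<subseteq> {a \<in> carrier G. h a \<in> genmonoid H (h ` U)}"
      using assms(5) genmonoid_incl[of "h ` U" H] by blast
  qed
  then show "h ` genmonoid G U \<subseteq> genmonoid H (h ` U)"
    by blast
qed

text \<open>Minimality against the preimage of an ideal. Only an inclusion can be expected, as the
  image of an ideal under a homomorphism that is not onto need not be an ideal; for localizations
  \<open>genideal_localization\<close> supplies a converse up to a denominator.\<close>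

lemma genideal_hom_subset:
  assumes "ring R" "ring T" "h \<in> ring_hom R T" "J \<subseteq> carrier R"
  shows "h ` genideal R J \<subseteq> genideal T (h ` J)"
proof -
  interpret R: ring R by fact
  interpret T: ring T by fact
  interpret H: ring_hom_ring R T h
    using assms by (intro ring_hom_ringI2)
  have hJ: "h ` J \<subseteq> carrier T"
    using assms(4) by auto
  have "genideal R J \<subseteq> {a \<in> carrier R. h a \<in> genideal T (h ` J)}"
    by (intro R.genideal_minimal H.ideal_vimage T.genideal_ideal hJ)
      (use assms(4) T.genideal_self[OF hJ] in blast)
  then show ?thesis
    by blast
qed


section \<open>Nested values with a variable innermost coefficient\<close>

text \<open>Each entry pairs a whole ideal with one fixed multiplier, so the \<open>j\<close> vary
  while the \<open>u\<close> stay. This makes the values depend linearly on the innermost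
  coefficient \<open>r\<close>; the value in the definition of collapse is the case
  \<open>r = \<one>\<close>.\<close>

fun nested_values :: "('a, 'b) ring_scheme \<Rightarrow> ('a set \<times> 'a) list \<Rightarrow> 'a \<Rightarrow> 'a set" where
  "nested_values R [] r = {r}"
| "nested_values R ((I, u) # ps) r =
     {u \<otimes>\<^bsub>R\<^esub> y \<oplus>\<^bsub>R\<^esub> j | y j. y \<in> nested_values R ps r \<and> j \<in> I}"

definition ideal_chain :: "('a, 'b) ring_scheme \<Rightarrow> ('a set \<times> 'a) list \<Rightarrow> bool" where
  "ideal_chain R ps \<longleftrightarrow> (\<forall>(I, u) \<in> set ps. ideal I R \<and> u \<in> carrier R)"

text \<open>The ideals are dictated by the chain, so the only freedom left is the choice of the
  multipliers.\<close>

definition chain_choice ::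
    "('a, 'b) ring_scheme \<Rightarrow> ('a set \<times> 'a) list \<Rightarrow> 'a idl_chain \<Rightarrow> bool" where
  "chain_choice R =
     list_all2 (\<lambda>(I, u) (J, U). I = genideal R J \<and> u \<in> genmonoid R U)"

definition chain_refines ::
    "('a, 'b) ring_scheme \<Rightarrow> ('a set \<times> 'a) list \<Rightarrow> ('a set \<times> 'a) list \<Rightarrow> bool" where
  "chain_refines R =
     list_all2 (\<lambda>(I, u) (I', u'). I \<subseteq> I' \<and> (\<exists>v\<in>carrier R. u' = u \<otimes>\<^bsub>R\<^esub> v))"

lemma ideal_chain_simps [simp]:
  "ideal_chain R []"
  "ideal_chain R ((I, u) # ps) \<longleftrightarrow> ideal I R \<and> u \<in> carrier R \<and> ideal_chain R ps"
  by (auto simp: ideal_chain_def)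

lemma idealistic_chain_iff:
  "idealistic_chain R C \<longleftrightarrow>
     C \<noteq> [] \<and> list_all (\<lambda>(J, U). J \<subseteq> carrier R \<and> U \<subseteq> carrier R) C"
  by (auto simp: idealistic_chain_def list_all_iff)

context cring
begin

lemma nested_values_closed:
  assumes "ideal_chain R ps" "r \<in> carrier R"
  shows "nested_values R ps r \<subseteq> carrier R"
  using assms
proof (induction ps)
  case (Cons p ps)
  obtain I u where p: "p = (I, u)" by force
  interpret I: ideal I R using Cons.prems p by simp
  show ?case using Cons p by (auto dest: I.Icarr)
qed simp

text \<open>Both values use the same multipliers, so they can be added level by level, the ideals
  absorbing the sums of the \<open>j\<close>.\<close>

lemma nested_values_add:
  assumes "ideal_chain R ps" "r \<in> carrier R" "s \<in> carrier R"
    and "y \<in> nested_values R ps r" "z \<in> nested_values R ps s"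
  shows "y \<oplus> z \<in> nested_values R ps (r \<oplus> s)"
  using assms(1,4,5)
proof (induction ps arbitrary: y z)
  case (Cons p ps)
  obtain I u where p: "p = (I, u)" by force
  interpret I: ideal I R using Cons.prems p by simp
  obtain y' j z' k where *: "y' \<in> nested_values R ps r" "j \<in> I" "y = u \<otimes> y' \<oplus> j"
    "z' \<in> nested_values R ps s" "k \<in> I" "z = u \<otimes> z' \<oplus> k"
    using Cons.prems p by auto
  have c: "u \<in> carrier R" "y' \<in> carrier R" "z' \<in> carrier R" "j \<in> carrier R" "k \<in> carrier R"
    using * Cons.prems p nested_values_closed assms(2,3) by (auto dest: I.Icarr)
  have "y \<oplus> z = u \<otimes> (y' \<oplus> z') \<oplus> (j \<oplus> k)"
    unfolding *(3,6) using c by algebra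
  moreover have "y' \<oplus> z' \<in> nested_values R ps (r \<oplus> s)"
    using Cons * p by auto
  ultimately show ?case
    using * p by auto
qed simp

lemma nested_values_mult:
  assumes "ideal_chain R ps" "r \<in> carrier R" "a \<in> carrier R" "y \<in> nested_values R ps r"
  shows "a \<otimes> y \<in> nested_values R ps (a \<otimes> r)"
  using assms(1,4)
proof (induction ps arbitrary: y)
  case (Cons p ps)
  obtain I u where p: "p = (I, u)" by force
  interpret I: ideal I R using Cons.prems p by simp
  obtain y' j where *: "y' \<in> nested_values R ps r" "j \<in> I" "y = u \<otimes> y' \<oplus> j"
    using Cons.prems p by auto
  have c: "u \<in> carrier R" "y' \<in> carrier R" "j \<in> carrier R"
    using * Cons.prems p nested_values_closed assms(2) by (auto dest: I.Icarr)
  have "a \<otimes> y = u \<otimes> (a \<otimes> y') \<oplus> a \<otimes> j"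
    unfolding *(3) using c assms(3) by algebra
  moreover have "a \<otimes> y' \<in> nested_values R ps (a \<otimes> r)" "a \<otimes> j \<in> I"
    using Cons * p assms(3) by (auto intro: I.I_l_closed)
  ultimately show ?case
    using p by auto
qed simp

lemma zero_in_nested_values_zero:
  assumes "ideal_chain R ps"
  shows "\<zero> \<in> nested_values R ps \<zero>"
  using assms
proof (induction ps)
  case (Cons p ps)
  obtain I u where p: "p = (I, u)" by force
  interpret I: ideal I R using Cons.prems p by simp
  have "\<zero> = u \<otimes> \<zero> \<oplus> \<zero>"
    using Cons.prems p by simp
  then show ?case
    using Cons p I.zero_closed by (auto intro!: exI[of _ \<zero>])
qed simp

text \<open>Sums and multiples of zero values are zero values, and by linearity they belong to the
  sums and multiples of the coefficients. This is the ideal to which comaximality is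
  applied.\<close>

lemma ideal_innermost_coefficients:
  assumes ps: "ideal_chain R ps"
  shows "ideal {r \<in> carrier R. \<zero> \<in> nested_values R ps r} R" (is "ideal ?A R")
proof (rule idealI)
  have l: "a \<otimes> r \<in> ?A" if "r \<in> ?A" "a \<in> carrier R" for r a
    using nested_values_mult[OF ps, of r a \<zero>] that by simp
  then show "a \<otimes> r \<in> ?A" if "r \<in> ?A" "a \<in> carrier R" for r a
    using that .
  then show "r \<otimes> a \<in> ?A" if "r \<in> ?A" "a \<in> carrier R" for r a
    using that m_comm[of r a] by simp
  show "subgroup ?A (add_monoid R)"
  proof (rule add.subgroupI)
    show "\<ominus> r \<in> ?A" if "r \<in> ?A" for r
      using l[of r "\<ominus> \<one>"] that by (simp add: l_minus)
    show "r \<oplus> s \<in> ?A" if "r \<in> ?A" "s \<in> ?A" for r s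
      using nested_values_add[OF ps, of r s \<zero> \<zero>] that by simp
  qed (use zero_in_nested_values_zero[OF ps] in auto)
qed (rule ring_axioms)

section \<open>Refinement of multipliers\<close>

lemma nested_values_refines:
  assumes "chain_refines R ps qs" "ideal_chain R ps" "ideal_chain R qs" "r \<in> carrier R"
  shows "\<exists>w\<in>carrier R. \<forall>y \<in> nested_values R ps r. w \<otimes> y \<in> nested_values R qs r"
  using assms(1-3) unfolding chain_refines_def
proof (induction rule: list_all2_induct)
  case Nil
  then show ?case using assms(4) by (auto intro!: bexI[of _ \<one>])
next
  case (Cons p ps q qs)
  obtain I u I' u' where pq: "p = (I, u)" "q = (I', u')" by force
  interpret I': ideal I' R using Cons.prems pq by simp
  from Cons.hyps pq obtain v where v: "I \<subseteq> I'" "v \<in> carrier R" "u' = u \<otimes> v" by auto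
  from Cons pq obtain w where
    w: "w \<in> carrier R" "\<And>y. y \<in> nested_values R ps r \<Longrightarrow> w \<otimes> y \<in> nested_values R qs r"
    by auto
  \<comment> \<open>The scaling factor grows from the inside out: \<open>w\<close> serves the inner
    levels, and \<open>v\<close> completes \<open>u\<close> to \<open>u'\<close> at the present
    level.\<close>
  have "(v \<otimes> w) \<otimes> y \<in> nested_values R (q # qs) r" if "y \<in> nested_values R (p # ps) r" for y
  proof -
    from that pq obtain y' j where *: "y' \<in> nested_values R ps r" "j \<in> I" "y = u \<otimes> y' \<oplus> j"
      by auto
    have c: "u \<in> carrier R" "y' \<in> carrier R" "j \<in> carrier R"
      using * Cons.prems pq v nested_values_closed assms(4) by (auto dest: I'.Icarr)
    have "(v \<otimes> w) \<otimes> y = u' \<otimes> (w \<otimes> y') \<oplus> (v \<otimes> w) \<otimes> j"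
      unfolding *(3) v(3) using c v(2) w(1) by algebra
    moreover have "(v \<otimes> w) \<otimes> j \<in> I'"
      using * v w by (auto intro!: I'.I_l_closed)
    ultimately show ?thesis
      using w(2)[OF *(1)] pq by auto
  qed
  then show ?case using v w by (intro bexI[of _ "v \<otimes> w"]) auto
qed

text \<open>Refinement preserves values only up to a factor, which does no harm to the value
  zero.\<close>

lemma zero_in_nested_values_refines:
  assumes "chain_refines R ps qs" "ideal_chain R ps" "ideal_chain R qs" "r \<in> carrier R"
    and "\<zero> \<in> nested_values R ps r"
  shows "\<zero> \<in> nested_values R qs r"
  using nested_values_refines[OF assms(1-4)] assms(5) by force

section \<open>Choices of multipliers and their common refinements\<close>

lemma ideal_chain_choice:
  assumes "chain_choice R ps C" "list_all (\<lambda>(J, U). J \<subseteq> carrier R \<and> U \<subseteq> carrier R) C"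
  shows "ideal_chain R ps"
  using assms unfolding chain_choice_def
proof (induction rule: list_all2_induct)
  case (Cons p ps c C)
  obtain J U where c: "c = (J, U)" by force
  interpret M: submonoid "genmonoid R U" R
    using Cons.prems c by (intro submonoid_genmonoid) simp
  show ?case
    using Cons c genideal_ideal[of J] M.subset by (cases p) auto
qed simp

text \<open>The default value \<open>\<one>\<close> at the empty list makes the last entry obey the
  general recursion, since \<open>u \<otimes> \<one> = u\<close>.\<close>

lemma nested_value_Cons:
  assumes "u \<in> carrier R"
  shows "nested_value R ((j, u) # ps) = u \<otimes> nested_value R ps \<oplus> j"
  using assms by (cases ps) auto

text \<open>The value \<open>z\<close> is arbitrary, and the chain may be empty, for the sake of the
  induction: when the whole value is zero, the inner ones usually are not.\<close>

lemma nested_values_one_iff: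
  assumes "list_all (\<lambda>(J, U). J \<subseteq> carrier R \<and> U \<subseteq> carrier R) C"
  shows "(\<exists>ps. list_all2 (\<lambda>(j, u) (J, U). j \<in> genideal R J \<and> u \<in> genmonoid R U) ps C \<and>
            nested_value R ps = z) \<longleftrightarrow>
         (\<exists>ps. chain_choice R ps C \<and> z \<in> nested_values R ps \<one>)"
  using assms
proof (induction C arbitrary: z)
  case Nil
  show ?case by (auto simp: chain_choice_def)
next
  case (Cons c C)
  obtain J U where c: "c = (J, U)" by force
  interpret M: submonoid "genmonoid R U" R
    using Cons.prems c by (intro submonoid_genmonoid) simp
  have carr: "u \<in> carrier R" if "u \<in> genmonoid R U" for u
    using that M.subset by blast
  have "(\<exists>ps. list_all2 (\<lambda>(j, u) (J, U). j \<in> genideal R J \<and> u \<in> genmonoid R U) ps (c # C) \<and>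
            nested_value R ps = z) \<longleftrightarrow>
     (\<exists>j u y. j \<in> genideal R J \<and> u \<in> genmonoid R U \<and> z = u \<otimes> y \<oplus> j \<and>
       (\<exists>ps. list_all2 (\<lambda>(j, u) (J, U). j \<in> genideal R J \<and> u \<in> genmonoid R U) ps C \<and>
            nested_value R ps = y))"
    by (auto simp: list_all2_Cons2 c nested_value_Cons carr) (metis nested_value_Cons carr)+
  also have "\<dots> \<longleftrightarrow> (\<exists>j u y. j \<in> genideal R J \<and> u \<in> genmonoid R U \<and> z = u \<otimes> y \<oplus> j \<and>
       (\<exists>ps. chain_choice R ps C \<and> y \<in> nested_values R ps \<one>))"
    using Cons by simp
  also have "\<dots> \<longleftrightarrow> (\<exists>ps. chain_choice R ps (c # C) \<and> z \<in> nested_values R ps \<one>)"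
    by (auto simp: chain_choice_def list_all2_Cons2 c) (fastforce)+
  finally show ?case .
qed

lemma collapses_iff:
  assumes "idealistic_chain R C"
  shows "collapses R C \<longleftrightarrow> (\<exists>ps. chain_choice R ps C \<and> \<zero> \<in> nested_values R ps \<one>)"
  unfolding collapses_def using assms
  by (intro nested_values_one_iff) (simp add: idealistic_chain_iff)

lemma refines_trans:
  assumes "chain_refines R ps qs" "chain_refines R qs rs" "ideal_chain R ps"
  shows "chain_refines R ps rs"
  using assms unfolding chain_refines_def
proof (induction ps arbitrary: qs rs rule: list.induct)
  case (Cons p ps)
  then show ?case
    by (cases p) (fastforce simp: list_all2_Cons1 m_assoc)
qed simp

text \<open>Multiply the two choices entry by entry: the product stays in the generated monoid and
  is a multiple of both factors, while the ideals agree already.\<close>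

lemma common_refinement:
  assumes "chain_choice R ps C" "chain_choice R qs C"
    and "list_all (\<lambda>(J, U). J \<subseteq> carrier R \<and> U \<subseteq> carrier R) C"
  shows "\<exists>rs. chain_choice R rs C \<and> chain_refines R ps rs \<and> chain_refines R qs rs"
  using assms unfolding chain_choice_def chain_refines_def
proof (induction C arbitrary: ps qs rule: list.induct)
  case (Cons c C)
  obtain J U where c: "c = (J, U)" by force
  interpret M: submonoid "genmonoid R U" R
    using Cons.prems c by (intro submonoid_genmonoid) simp
  obtain u ps' v qs' where *: "ps = (genideal R J, u) # ps'" "qs = (genideal R J, v) # qs'"
    "u \<in> genmonoid R U" "v \<in> genmonoid R U"
    "chain_choice R ps' C" "chain_choice R qs' C"
    using Cons.prems c by (auto simp: list_all2_Cons2 chain_choice_def)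
  then obtain rs where "chain_choice R rs C" "chain_refines R ps' rs" "chain_refines R qs' rs"
    using Cons unfolding chain_choice_def chain_refines_def by force
  moreover have "\<exists>w\<in>carrier R. u \<otimes> v = u \<otimes> w" "\<exists>w\<in>carrier R. u \<otimes> v = v \<otimes> w"
    using * M.subset m_comm by blast+
  ultimately show ?case
    using * c
    by (intro exI[of _ "(genideal R J, u \<otimes> v) # rs"])
      (auto simp: chain_choice_def chain_refines_def)
qed simp

text \<open>The choice with all multipliers \<open>\<one>\<close> starts the induction over finite
  families, and so also covers an empty family of monoids.\<close>

lemma chain_choice_exists:
  assumes "list_all (\<lambda>(J, U). J \<subseteq> carrier R \<and> U \<subseteq> carrier R) C"
  shows "\<exists>ps. chain_choice R ps C"
proof -
  have "\<one> \<in> genmonoid R U" if "U \<subseteq> carrier R" for U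
    using submonoid_genmonoid[OF that] by (rule submonoid.one_closed)
  then have "chain_choice R (map (\<lambda>(J, U). (genideal R J, \<one>)) C) C"
    using assms by (auto simp: chain_choice_def list_all2_conv_all_nth list_all_length split: prod.splits)
  then show ?thesis ..
qed

lemma common_refinement_family:
  assumes "list_all (\<lambda>(J, U). J \<subseteq> carrier R \<and> U \<subseteq> carrier R) C"
    and "finite A" "\<And>i. i \<in> A \<Longrightarrow> chain_choice R (ps i) C"
  shows "\<exists>qs. chain_choice R qs C \<and> (\<forall>i\<in>A. chain_refines R (ps i) qs)"
  using assms(2,3)
proof (induction rule: finite_induct)
  case empty
  show ?case using chain_choice_exists[OF assms(1)] by simp
next
  case (insert k A)
  then obtain qs where qs: "chain_choice R qs C" "\<forall>i\<in>A. chain_refines R (ps i) qs"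
    by auto
  obtain rs where rs: "chain_choice R rs C" "chain_refines R qs rs" "chain_refines R (ps k) rs"
    using common_refinement[OF qs(1) insert.prems[of k] assms(1)] by auto
  then have "\<forall>i\<in>insert k A. chain_refines R (ps i) rs"
    using qs insert.prems ideal_chain_choice[OF _ assms(1)] refines_trans by blast
  with rs show ?case by blast
qed

section \<open>Gluing over comaximal monoids\<close>

lemma collapses_comaximal:
  assumes C: "idealistic_chain R C" and "comaximal R n S"
    and "\<And>i. i \<in> {1..n} \<Longrightarrow> S i \<subseteq> carrier R"
    and "\<And>i. i \<in> {1..n} \<Longrightarrow>
           \<exists>ps. \<exists>s\<in>S i. chain_choice R ps C \<and> \<zero> \<in> nested_values R ps s"
  shows "collapses R C"
proof -
  have lC: "list_all (\<lambda>(J, U). J \<subseteq> carrier R \<and> U \<subseteq> carrier R) C"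
    using C by (simp add: idealistic_chain_iff)
  have "\<forall>i\<in>{1..n}. \<exists>ps. \<exists>s\<in>S i. chain_choice R ps C \<and> \<zero> \<in> nested_values R ps s"
    using assms(4) by blast
  then obtain ps where ps: "\<And>i. i \<in> {1..n} \<Longrightarrow>
      \<exists>s\<in>S i. chain_choice R (ps i) C \<and> \<zero> \<in> nested_values R (ps i) s"
    by metis
  then obtain qs where qs: "chain_choice R qs C" "\<And>i. i \<in> {1..n} \<Longrightarrow> chain_refines R (ps i) qs"
    using common_refinement_family[OF lC, of "{1..n}" ps] by auto
  note ic = ideal_chain_choice[OF _ lC]
  let ?A = "{r \<in> carrier R. \<zero> \<in> nested_values R qs r}"
  \<comment> \<open>The coefficient \<open>s\<close> found for \<open>ps i\<close> also works for
    the common refinement \<open>qs\<close>, because refining leaves the innermost coefficient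
    unchanged.\<close>
  have "?A \<inter> S i \<noteq> {}" if i: "i \<in> {1..n}" for i
  proof -
    obtain s where s: "s \<in> S i" "chain_choice R (ps i) C" "\<zero> \<in> nested_values R (ps i) s"
      using ps[OF i] by blast
    then have "s \<in> carrier R" using assms(3)[OF i] by blast
    then have "\<zero> \<in> nested_values R qs s"
      using zero_in_nested_values_refines[OF qs(2)[OF i] ic ic] s qs by blast
    then show ?thesis using s \<open>s \<in> carrier R\<close> by blast
  qed
  then have "\<one> \<in> ?A"
    using assms(2) ideal_innermost_coefficients[OF ic[OF qs(1)]] unfolding comaximal_def by blast
  then show ?thesis
    using qs collapses_iff[OF C] by blast
qed

text \<open>The two conditions say that every choice for \<open>C\<close> is refined by some choice
  for \<open>D\<close>. The criterion serves to compare elementary chains whose entries differ by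
  units.\<close>

lemma collapses_mono:
  assumes "idealistic_chain R C" "idealistic_chain R D"
    and CD: "list_all2 (\<lambda>(J, U) (J', U'). genideal R J \<subseteq> genideal R J' \<and>
           (\<forall>u\<in>genmonoid R U. \<exists>v\<in>carrier R. u \<otimes> v \<in> genmonoid R U')) C D"
    and "collapses R C"
  shows "collapses R D"
proof -
  obtain ps where ps: "chain_choice R ps C" "\<zero> \<in> nested_values R ps \<one>"
    using assms collapses_iff by blast
  have "\<exists>qs. chain_choice R qs D \<and> chain_refines R ps qs"
    using CD ps(1) unfolding chain_choice_def chain_refines_def
  proof (induction arbitrary: ps rule: list_all2_induct)
    case (Cons c C d D)
    obtain J U J' U' where cd: "c = (J, U)" "d = (J', U')" by force
    obtain u ps' where p: "ps = (genideal R J, u) # ps'" "u \<in> genmonoid R U"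
      "chain_choice R ps' C"
      using Cons.prems cd by (auto simp: list_all2_Cons2 chain_choice_def)
    then obtain qs where "chain_choice R qs D" "chain_refines R ps' qs"
      using Cons.IH unfolding chain_choice_def chain_refines_def by blast
    moreover obtain v where "v \<in> carrier R" "u \<otimes> v \<in> genmonoid R U'"
      using Cons.hyps cd p by auto
    ultimately show ?case
      using Cons.hyps cd p
      by (intro exI[of _ "(genideal R J', u \<otimes> v) # qs"])
        (auto simp: chain_choice_def chain_refines_def)
  qed simp
  then obtain qs where "chain_choice R qs D" "chain_refines R ps qs" by blast
  then show ?thesis
    using zero_in_nested_values_refines[of ps qs \<one>] ps assms(1,2) collapses_iff
      ideal_chain_choice by (auto simp: idealistic_chain_iff)
qed

section \<open>Elementary chains up to units\<close>

lemma idealistic_elementary_chain: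
  assumes "set xs \<subseteq> carrier R"
  shows "idealistic_chain R (elementary_chain R xs)"
proof -
  have "\<forall>(J, U) \<in> set (map2 (\<lambda>x y. ({x}, {y})) as bs). J \<subseteq> carrier R \<and> U \<subseteq> carrier R"
    if "set as \<subseteq> carrier R" "set bs \<subseteq> carrier R" for as bs
    using that by (auto dest: set_zip_leftD set_zip_rightD)
  from this[of "\<zero> # xs" "xs @ [\<one>]"] show ?thesis
    using assms by (cases xs) (simp_all add: idealistic_chain_def elementary_chain_def)
qed

text \<open>A power of \<open>w \<otimes> x\<close> becomes a power of \<open>x\<close> when
  multiplied by a power of \<open>inv w\<close>. Explicit powers are avoided: the elements with a
  multiple in \<open>genmonoid R {x}\<close> form a submonoid, so the generator suffices.\<close>

lemma genmonoid_unit_multiple: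
  assumes "w \<in> Units R" "x \<in> carrier R" "u \<in> genmonoid R {w \<otimes> x}"
  shows "\<exists>v\<in>carrier R. u \<otimes> v \<in> genmonoid R {x}"
proof -
  interpret M: submonoid "genmonoid R {x}" R
    using assms by (intro submonoid_genmonoid) simp
  let ?H = "{u \<in> carrier R. \<exists>v\<in>carrier R. u \<otimes> v \<in> genmonoid R {x}}"
  have "genmonoid R {w \<otimes> x} \<subseteq> ?H"
  proof (rule genmonoid_minimal)
    show "submonoid ?H R"
    proof
      fix a b assume "a \<in> ?H" "b \<in> ?H"
      then obtain v v' where v: "a \<in> carrier R" "b \<in> carrier R" "v \<in> carrier R" "v' \<in> carrier R"
        "a \<otimes> v \<in> genmonoid R {x}" "b \<otimes> v' \<in> genmonoid R {x}" by blast
      have "(a \<otimes> b) \<otimes> (v \<otimes> v') = (a \<otimes> v) \<otimes> (b \<otimes> v')"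
        using v(1-4) by algebra
      with M.m_closed[OF v(5,6)] v show "a \<otimes> b \<in> ?H"
        by (auto intro!: bexI[of _ "v \<otimes> v'"])
    qed (use M.one_closed in \<open>auto intro!: bexI[of _ \<one>]\<close>)
    have "(w \<otimes> x) \<otimes> inv w = (x \<otimes> w) \<otimes> inv w"
      using assms by (simp add: m_comm Units_closed)
    also have "\<dots> = x"
      using assms by (simp add: m_assoc Units_closed)
    finally have "(w \<otimes> x) \<otimes> inv w = x" .
    then show "{w \<otimes> x} \<subseteq> ?H"
      using assms genmonoid_incl[of "{x}" R] by (auto intro!: bexI[of _ "inv w"])
  qed
  then show ?thesis using assms by blast
qed

lemma collapses_elementary_chain_units:
  assumes "list_all2 (\<lambda>y x. \<exists>w\<in>Units R. y = w \<otimes> x) ys xs" "set xs \<subseteq> carrier R"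
    and "collapses R (elementary_chain R ys)"
  shows "collapses R (elementary_chain R xs)"
proof (rule collapses_mono[OF _ _ _ assms(3)])
  have "set ys \<subseteq> carrier R"
    using assms(1,2) by (induction rule: list_all2_induct) auto
  then show "idealistic_chain R (elementary_chain R ys)"
    "idealistic_chain R (elementary_chain R xs)"
    using assms by (auto intro: idealistic_elementary_chain)
  let ?Q = "\<lambda>y x. x \<in> carrier R \<and> (\<exists>w\<in>Units R. y = w \<otimes> x)"
  have Q: "list_all2 ?Q ys xs"
    using assms(1,2) by (induction rule: list_all2_induct) auto
  \<comment> \<open>The outer entries \<open>\<zero>\<close> and \<open>\<one>\<close> of an
    elementary chain are related through the unit \<open>\<one>\<close>.\<close>
  have "?Q \<zero> \<zero>" "?Q \<one> \<one>"
    by (auto intro!: bexI[of _ \<one>])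
  then have "list_all2 ?Q (\<zero> # ys) (\<zero> # xs)" "list_all2 ?Q (ys @ [\<one>]) (xs @ [\<one>])"
    using Q by (auto intro: list_all2_appendI)
  \<comment> \<open>The left and the right components of an elementary chain are shifted against
    each other, so the induction treats them as independent lists.\<close>
  moreover have "list_all2 (\<lambda>(J, U) (J', U'). genideal R J \<subseteq> genideal R J' \<and>
      (\<forall>u\<in>genmonoid R U. \<exists>v\<in>carrier R. u \<otimes> v \<in> genmonoid R U'))
      (map2 (\<lambda>x y. ({x}, {y})) as bs) (map2 (\<lambda>x y. ({x}, {y})) cs ds)"
    if "list_all2 ?Q as cs" "list_all2 ?Q bs ds" for as bs cs ds
    using that
  proof (induction as cs arbitrary: bs ds rule: list_all2_induct)
    case (Cons a as c cs)
    have "genideal R {a} \<subseteq> genideal R {c}"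
    proof -
      interpret I: ideal "genideal R {c}" R
        using Cons.hyps by (intro genideal_ideal) auto
      have "a \<in> genideal R {c}"
        using Cons.hyps genideal_self'[of c] by (auto intro!: I.I_l_closed)
      then show ?thesis
        by (intro genideal_minimal I.ideal_axioms) auto
    qed
    then show ?case
      using Cons.prems Cons.IH genmonoid_unit_multiple
      by (cases bs) (auto simp: list_all2_Cons1)
  qed simp
  ultimately show "list_all2 (\<lambda>(J, U) (J', U'). genideal R J \<subseteq> genideal R J' \<and>
      (\<forall>u\<in>genmonoid R U. \<exists>v\<in>carrier R. u \<otimes> v \<in> genmonoid R U'))
      (elementary_chain R ys) (elementary_chain R xs)"
    unfolding elementary_chain_def by blast
qed

end


section \<open>Collapse and ring homomorphisms\<close>

lemma idealistic_image_chain: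
  assumes "idealistic_chain R C" "h \<in> carrier R \<rightarrow> carrier T"
  shows "idealistic_chain T (image_chain h C)"
  using assms by (fastforce simp: idealistic_chain_def image_chain_def)

lemma image_elementary_chain:
  assumes "h \<zero>\<^bsub>R\<^esub> = \<zero>\<^bsub>T\<^esub>" "h \<one>\<^bsub>R\<^esub> = \<one>\<^bsub>T\<^esub>"
  shows "image_chain h (elementary_chain R xs) = elementary_chain T (map h xs)"
proof -
  have "image_chain h (map2 (\<lambda>x y. ({x}, {y})) as bs) =
      map2 (\<lambda>x y. ({x}, {y})) (map h as) (map h bs)" for as bs
    by (auto simp: image_chain_def zip_map1 zip_map2)
  from this[of "\<zero>\<^bsub>R\<^esub> # xs" "xs @ [\<one>\<^bsub>R\<^esub>]"] show ?thesis
    using assms by (simp add: elementary_chain_def)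
qed

text \<open>A homomorphism carries the multipliers into the generated monoids and the
  \<open>j\<close> into the generated ideals of the image chain, hence a vanishing nested value to a
  vanishing one.\<close>

lemma collapses_image_chain:
  assumes "cring R" "cring T" and h: "h \<in> ring_hom R T"
    and C: "idealistic_chain R C" and "collapses R C"
  shows "collapses T (image_chain h C)"
proof -
  interpret R: cring R by fact
  interpret T: cring T by fact
  interpret H: ring_hom_cring R T h
    using assms by (intro ring_hom_cring.intro ring_hom_cring_axioms.intro)
  \<comment> \<open>Stated for any value \<open>z\<close>, since the inner values of a collapse need
    not vanish.\<close>
  have nv: "\<exists>qs. chain_choice T qs (image_chain h C) \<and> h z \<in> nested_values T qs \<one>\<^bsub>T\<^esub>"
    if "list_all (\<lambda>(J, U). J \<subseteq> carrier R \<and> U \<subseteq> carrier R) C"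
      "chain_choice R ps C" "z \<in> nested_values R ps \<one>\<^bsub>R\<^esub>" for ps z C
    using that(2,1,3) unfolding chain_choice_def
  proof (induction arbitrary: z rule: list_all2_induct)
    case Nil
    then show ?case by (auto simp: image_chain_def)
  next
    case (Cons p ps c C)
    obtain J U where c: "c = (J, U)" by force
    obtain u where p: "p = (genideal R J, u)" "u \<in> genmonoid R U"
      using Cons.hyps c by auto
    have ic: "ideal_chain R (p # ps)"
      using Cons.hyps Cons.prems by (intro R.ideal_chain_choice[of _ "c # C"])
        (auto simp: chain_choice_def)
    interpret I: ideal "genideal R J" R using ic p by simp
    obtain y j where *: "y \<in> nested_values R ps \<one>\<^bsub>R\<^esub>" "j \<in> genideal R J"
      "z = u \<otimes>\<^bsub>R\<^esub> y \<oplus>\<^bsub>R\<^esub> j"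
      using Cons.prems p by auto
    have "h u \<in> genmonoid T (h ` U)"
      using genmonoid_hom_image[of R T h U] p Cons.prems c H.homh
      by (auto simp: ring_hom_def hom_def intro: R.monoid_axioms T.monoid_axioms)
    moreover have "h j \<in> genideal T (h ` J)"
      using genideal_hom_subset[OF R.ring_axioms T.ring_axioms h, of J] * Cons.prems c by auto
    moreover obtain qs where "chain_choice T qs (image_chain h C)"
      "h y \<in> nested_values T qs \<one>\<^bsub>T\<^esub>"
      using Cons.IH[OF _ *(1)] Cons.prems by (auto simp: chain_choice_def)
    moreover have "h z = h u \<otimes>\<^bsub>T\<^esub> h y \<oplus>\<^bsub>T\<^esub> h j"
      using * p ic R.nested_values_closed[of ps "\<one>\<^bsub>R\<^esub>"] by (auto dest: I.Icarr)
    ultimately show ?case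
      by (intro exI[of _ "(genideal T (h ` J), h u) # qs"])
        (auto simp: chain_choice_def image_chain_def c)
  qed
  from \<open>collapses R C\<close> obtain ps where "chain_choice R ps C" "\<zero>\<^bsub>R\<^esub> \<in> nested_values R ps \<one>\<^bsub>R\<^esub>"
    using R.collapses_iff[OF C] by blast
  from nv[OF _ this] have "\<exists>qs. chain_choice T qs (image_chain h C) \<and>
      \<zero>\<^bsub>T\<^esub> \<in> nested_values T qs \<one>\<^bsub>T\<^esub>"
    using C by (simp add: idealistic_chain_iff)
  then show ?thesis
    using T.collapses_iff[OF idealistic_image_chain[OF C]] h by (auto simp: ring_hom_def)
qed


section \<open>Collapse in a localization\<close>

context cring_submonoid
begin

abbreviation "L \<equiv> localization R S"
abbreviation "\<phi> \<equiv> loc_map R S"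

lemma loc_map_ring_hom_cring: "ring_hom_cring R L \<phi>"
  by (intro ring_hom_cring.intro ring_hom_cring_axioms.intro loc_map_ring_hom is_cring
      cring_localization)

lemma loc_map_eq_zero:
  assumes "a \<in> carrier R" "\<phi> a = \<zero>\<^bsub>L\<^esub>"
  shows "\<exists>s\<in>S. s \<otimes> a = \<zero>"
  using assms frac_eq_iff[of a \<one> \<zero> \<one>] by (auto simp: loc_map_def zero_localization minus_eq)

lemma localization_clear_denominator:
  assumes "x \<in> carrier L"
  shows "\<exists>s\<in>S. \<exists>a\<in>carrier R. \<phi> s \<otimes>\<^bsub>L\<^esub> x = \<phi> a"
proof -
  obtain a s where as: "x = loc_frac R S a s" "a \<in> carrier R" "s \<in> S"
    using assms by (auto simp: carrier_localization)
  have "\<phi> s \<otimes>\<^bsub>L\<^esub> x = loc_frac R S (s \<otimes> a) s"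
    using as by (simp add: loc_map_def frac_mult)
  also have "\<dots> = \<phi> a"
    unfolding loc_map_def using as by (intro frac_eqI) auto
  finally show ?thesis using as by blast
qed

text \<open>The elements that some \<open>s\<close> in \<open>S\<close> carries into the image of
  \<open>genideal R J\<close> form an ideal of \<open>L\<close> containing the generators;
  denominators multiply along the way.\<close>

lemma genideal_localization:
  assumes J: "J \<subseteq> carrier R" and x: "x \<in> genideal L (\<phi> ` J)"
  shows "\<exists>s\<in>S. \<exists>j\<in>genideal R J. \<phi> s \<otimes>\<^bsub>L\<^esub> x = \<phi> j"
proof -
  interpret L: cring L by (rule cring_localization)
  interpret H: ring_hom_cring R L \<phi> by (rule loc_map_ring_hom_cring)
  interpret I: ideal "genideal R J" R by (rule genideal_ideal) fact
  let ?I = "{x \<in> carrier L. \<exists>s\<in>S. \<exists>j\<in>genideal R J. \<phi> s \<otimes>\<^bsub>L\<^esub> x = \<phi> j}"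
  have mult: "y \<otimes>\<^bsub>L\<^esub> x \<in> ?I" if xy: "x \<in> ?I" "y \<in> carrier L" for x y
  proof -
    obtain s j where s: "x \<in> carrier L" "s \<in> S" "j \<in> genideal R J" "\<phi> s \<otimes>\<^bsub>L\<^esub> x = \<phi> j"
      using xy(1) by blast
    obtain t a where t: "t \<in> S" "a \<in> carrier R" "\<phi> t \<otimes>\<^bsub>L\<^esub> y = \<phi> a"
      using localization_clear_denominator[OF xy(2)] by blast
    have c: "\<phi> s \<in> carrier L" "\<phi> t \<in> carrier L" "j \<in> carrier R"
      using s t by (auto dest: I.Icarr)
    have "\<phi> (t \<otimes> s) \<otimes>\<^bsub>L\<^esub> (y \<otimes>\<^bsub>L\<^esub> x) = (\<phi> t \<otimes>\<^bsub>L\<^esub> y) \<otimes>\<^bsub>L\<^esub> (\<phi> s \<otimes>\<^bsub>L\<^esub> x)"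
      using s(1,2) t(1) c xy(2) by (simp add: L.m_ac)
    also have "\<dots> = \<phi> (a \<otimes> j)"
      using s t c by simp
    finally have "\<phi> (t \<otimes> s) \<otimes>\<^bsub>L\<^esub> (y \<otimes>\<^bsub>L\<^esub> x) = \<phi> (a \<otimes> j)" .
    moreover have "a \<otimes> j \<in> genideal R J" "t \<otimes> s \<in> S" "y \<otimes>\<^bsub>L\<^esub> x \<in> carrier L"
      using s t xy I.I_l_closed by auto
    ultimately show ?thesis
      by blast
  qed
  have "ideal ?I L"
  proof (rule idealI)
    show "subgroup ?I (add_monoid L)"
    proof (rule L.add.subgroupI)
      have "\<phi> \<one> \<otimes>\<^bsub>L\<^esub> \<zero>\<^bsub>L\<^esub> = \<phi> \<zero>"
        by simp
      then have "\<zero>\<^bsub>L\<^esub> \<in> ?I"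
        using I.zero_closed submonoid.one_closed[OF submonoid_axioms] L.zero_closed by blast
      then show "?I \<noteq> {}" by blast
      show "\<ominus>\<^bsub>L\<^esub> x \<in> ?I" if "x \<in> ?I" for x
        using mult[OF that, of "\<ominus>\<^bsub>L\<^esub> \<one>\<^bsub>L\<^esub>"] that by (simp add: L.l_minus)
      fix x y assume "x \<in> ?I" "y \<in> ?I"
      then obtain s j t k where *: "x \<in> carrier L" "s \<in> S" "j \<in> genideal R J"
        "\<phi> s \<otimes>\<^bsub>L\<^esub> x = \<phi> j" "y \<in> carrier L" "t \<in> S" "k \<in> genideal R J"
        "\<phi> t \<otimes>\<^bsub>L\<^esub> y = \<phi> k" by blast
      have c: "\<phi> s \<in> carrier L" "\<phi> t \<in> carrier L" "j \<in> carrier R" "k \<in> carrier R"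
        using * by (auto dest: I.Icarr)
      have "\<phi> (s \<otimes> t) \<otimes>\<^bsub>L\<^esub> (x \<oplus>\<^bsub>L\<^esub> y) =
          \<phi> t \<otimes>\<^bsub>L\<^esub> (\<phi> s \<otimes>\<^bsub>L\<^esub> x) \<oplus>\<^bsub>L\<^esub> \<phi> s \<otimes>\<^bsub>L\<^esub> (\<phi> t \<otimes>\<^bsub>L\<^esub> y)"
        using *(1,2,5,6) c by (simp add: L.m_ac L.r_distr)
      also have "\<dots> = \<phi> (t \<otimes> j \<oplus> s \<otimes> k)"
        using * c by simp
      finally have "\<phi> (s \<otimes> t) \<otimes>\<^bsub>L\<^esub> (x \<oplus>\<^bsub>L\<^esub> y) = \<phi> (t \<otimes> j \<oplus> s \<otimes> k)" .
      moreover have "t \<otimes> j \<oplus> s \<otimes> k \<in> genideal R J"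
        using * by (intro I.a_closed I.I_l_closed) auto
      moreover have "s \<otimes> t \<in> S" "x \<oplus>\<^bsub>L\<^esub> y \<in> carrier L"
        using * by auto
      ultimately show "x \<oplus>\<^bsub>L\<^esub> y \<in> ?I"
        by blast
    qed auto
    show "x \<otimes>\<^bsub>L\<^esub> y \<in> ?I" if "x \<in> ?I" "y \<in> carrier L" for x y
      using mult[OF that] that L.m_comm by auto
  qed (use mult in \<open>auto intro: L.ring_axioms\<close>)
  moreover have "\<phi> ` J \<subseteq> ?I"
  proof
    fix x assume "x \<in> \<phi> ` J"
    then obtain j where j: "j \<in> J" "x = \<phi> j" by blast
    then have "j \<in> carrier R" "j \<in> genideal R J"
      using J genideal_self[OF J] by auto
    then have "x \<in> carrier L" "\<phi> \<one> \<otimes>\<^bsub>L\<^esub> x = \<phi> j"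
      using j by auto
    with \<open>j \<in> genideal R J\<close> show "x \<in> ?I"
      using one_closed by blast
  qed
  ultimately show ?thesis
    using L.genideal_minimal x by blast
qed

text \<open>Clearing denominators also multiplies the innermost \<open>\<one>\<close>, so the value
  in \<open>R\<close> has innermost coefficient \<open>s\<close> in \<open>S\<close>. This is why
  that coefficient was made variable.\<close>

lemma nested_values_localization:
  assumes "chain_choice L qs (image_chain \<phi> C)"
    and "list_all (\<lambda>(J, U). J \<subseteq> carrier R \<and> U \<subseteq> carrier R) C"
    and "y \<in> nested_values L qs \<one>\<^bsub>L\<^esub>"
  shows "\<exists>ps. chain_choice R ps C \<and>
           (\<exists>s\<in>S. \<exists>z\<in>nested_values R ps s. \<phi> s \<otimes>\<^bsub>L\<^esub> y = \<phi> z)"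
  using assms
proof (induction C arbitrary: qs y)
  case Nil
  interpret L: cring L by (rule cring_localization)
  show ?case
    using Nil loc_map_ring_hom
    by (auto simp: chain_choice_def image_chain_def ring_hom_def intro!: bexI[of _ \<one>])
next
  case (Cons c C)
  interpret L: cring L by (rule cring_localization)
  interpret H: ring_hom_cring R L \<phi> by (rule loc_map_ring_hom_cring)
  obtain J U where c: "c = (J, U)" by force
  interpret M: submonoid "genmonoid R U" R
    using Cons.prems c by (intro submonoid_genmonoid) simp
  interpret I: ideal "genideal R J" R
    using Cons.prems c by (intro genideal_ideal) simp
  obtain u' qs' where qs: "qs = (genideal L (\<phi> ` J), u') # qs'" "u' \<in> genmonoid L (\<phi> ` U)"
    "chain_choice L qs' (image_chain \<phi> C)"
    using Cons.prems(1) c by (auto simp: chain_choice_def image_chain_def list_all2_Cons2)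
  have "u' \<in> \<phi> ` genmonoid R U"
    using genmonoid_hom_image[of R L \<phi> U] qs(2) Cons.prems c loc_map_ring_hom
    by (auto simp: ring_hom_def hom_def intro: monoid_axioms L.monoid_axioms)
  then obtain u where u: "u \<in> genmonoid R U" "u' = \<phi> u" by blast
  obtain y' k where y: "y' \<in> nested_values L qs' \<one>\<^bsub>L\<^esub>" "k \<in> genideal L (\<phi> ` J)"
    "y = u' \<otimes>\<^bsub>L\<^esub> y' \<oplus>\<^bsub>L\<^esub> k"
    using Cons.prems(3) qs(1) by auto
  obtain ps s z where ps: "chain_choice R ps C" "s \<in> S" "z \<in> nested_values R ps s"
    "\<phi> s \<otimes>\<^bsub>L\<^esub> y' = \<phi> z"
    using Cons.IH[OF qs(3) _ y(1)] Cons.prems(2) by auto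
  obtain t j where t: "t \<in> S" "j \<in> genideal R J" "\<phi> t \<otimes>\<^bsub>L\<^esub> k = \<phi> j"
    using genideal_localization[OF _ y(2)] Cons.prems c by auto
  have ic: "ideal_chain R ps"
    using ideal_chain_choice[OF ps(1)] Cons.prems by simp
  have "\<phi> ` J \<subseteq> carrier L"
    using Cons.prems c by auto
  then interpret K: ideal "genideal L (\<phi> ` J)" L
    by (rule L.genideal_ideal)
  have icL: "ideal_chain L qs'"
    using Cons.prems(2) qs(3) by (intro L.ideal_chain_choice[of _ "image_chain \<phi> C"])
      (fastforce simp: image_chain_def list_all_iff)+
  have cc: "u \<in> carrier R" "s \<in> carrier R" "t \<in> carrier R" "z \<in> carrier R" "j \<in> carrier R"
    using u ps t M.subset nested_values_closed[OF ic, of s] by (auto dest: I.Icarr)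
  have "y' \<in> carrier L" "k \<in> carrier L"
    using y L.nested_values_closed[OF icL] by (auto dest: K.Icarr)
  note cL = this
  \<comment> \<open>Here \<open>s\<close> clears the inner value \<open>y'\<close> and
    \<open>t\<close> clears the ideal element \<open>k\<close>; each summand also receives the other
    factor.\<close>
  have "\<phi> (t \<otimes> s) \<otimes>\<^bsub>L\<^esub> y =
      \<phi> u \<otimes>\<^bsub>L\<^esub> (\<phi> t \<otimes>\<^bsub>L\<^esub> (\<phi> s \<otimes>\<^bsub>L\<^esub> y')) \<oplus>\<^bsub>L\<^esub> \<phi> s \<otimes>\<^bsub>L\<^esub> (\<phi> t \<otimes>\<^bsub>L\<^esub> k)"
    unfolding y(3) u(2) using cc cL by (simp add: L.m_ac L.r_distr)
  also have "\<dots> = \<phi> (u \<otimes> (t \<otimes> z) \<oplus> s \<otimes> j)"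
    using ps t cc by simp
  finally have eq: "\<phi> (t \<otimes> s) \<otimes>\<^bsub>L\<^esub> y = \<phi> (u \<otimes> (t \<otimes> z) \<oplus> s \<otimes> j)" .
  \<comment> \<open>By linearity the extra factor \<open>t\<close> moves into the innermost
    coefficient.\<close>
  have "t \<otimes> z \<in> nested_values R ps (t \<otimes> s)" "s \<otimes> j \<in> genideal R J"
    using nested_values_mult[OF ic] ps t cc I.I_l_closed by auto
  then have "u \<otimes> (t \<otimes> z) \<oplus> s \<otimes> j \<in> nested_values R ((genideal R J, u) # ps) (t \<otimes> s)"
    by auto
  moreover have "chain_choice R ((genideal R J, u) # ps) (c # C)"
    using ps(1) u c by (simp add: chain_choice_def)
  ultimately show ?case
    using eq ps(2) t(1) m_closed by blast
qed

lemma collapses_localizationD: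
  assumes C: "idealistic_chain R C" and "collapses L (image_chain \<phi> C)"
  shows "\<exists>ps. \<exists>s\<in>S. chain_choice R ps C \<and> \<zero> \<in> nested_values R ps s"
proof -
  interpret L: cring L by (rule cring_localization)
  interpret H: ring_hom_cring R L \<phi> by (rule loc_map_ring_hom_cring)
  have lC: "list_all (\<lambda>(J, U). J \<subseteq> carrier R \<and> U \<subseteq> carrier R) C"
    using C by (simp add: idealistic_chain_iff)
  have "idealistic_chain L (image_chain \<phi> C)"
    by (rule idealistic_image_chain[OF C]) auto
  then obtain qs where "chain_choice L qs (image_chain \<phi> C)" "\<zero>\<^bsub>L\<^esub> \<in> nested_values L qs \<one>\<^bsub>L\<^esub>"
    using assms(2) L.collapses_iff by blast
  from nested_values_localization[OF this(1) lC this(2)] obtain ps s z where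
    *: "chain_choice R ps C" "s \<in> S" "z \<in> nested_values R ps s" "\<phi> z = \<zero>\<^bsub>L\<^esub>"
    by auto
  have ic: "ideal_chain R ps"
    using ideal_chain_choice[OF *(1) lC] .
  then have "z \<in> carrier R"
    using nested_values_closed[of ps s] * by auto
  \<comment> \<open>A value that vanishes in \<open>L\<close> is only annihilated by some
    \<open>t\<close> in \<open>S\<close>. Scaling by \<open>t\<close> makes it zero in
    \<open>R\<close> and changes the coefficient to \<open>t \<otimes> s\<close>, which is still in
    \<open>S\<close>.\<close>
  then obtain t where "t \<in> S" "t \<otimes> z = \<zero>"
    using loc_map_eq_zero * by blast
  then show ?thesis
    using nested_values_mult[OF ic, of s t z] * by (intro exI[of _ ps] bexI[of _ "t \<otimes> s"]) auto
qed

section \<open>Krull dimension of a localization\<close>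

lemma krull_dim_le_localization:
  assumes "krull_dim_le R l"
  shows "krull_dim_le L l"
proof -
  interpret L: cring L by (rule cring_localization)
  interpret H: ring_hom_cring R L \<phi> by (rule loc_map_ring_hom_cring)
  show ?thesis
  proof (cases "l = -1")
    case True
    then show ?thesis
      using assms H.hom_one H.hom_zero by (simp add: krull_dim_le_def)
  next
    case False
    have "collapses L (elementary_chain L xs)"
      if xs: "int (length xs) = l + 1" "set xs \<subseteq> carrier L" for xs
    proof -
      \<comment> \<open>Each entry is cleared by its own denominator, whose image is a unit of
        \<open>L\<close>.\<close>
      have "\<exists>as. set as \<subseteq> carrier R \<and>
          list_all2 (\<lambda>y x. \<exists>w\<in>Units L. y = w \<otimes>\<^bsub>L\<^esub> x) (map \<phi> as) xs"
        using xs(2)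
      proof (induction xs)
        case (Cons x xs)
        then obtain as where "set as \<subseteq> carrier R"
          "list_all2 (\<lambda>y x. \<exists>w\<in>Units L. y = w \<otimes>\<^bsub>L\<^esub> x) (map \<phi> as) xs" by auto
        moreover obtain s a where "s \<in> S" "a \<in> carrier R" "\<phi> s \<otimes>\<^bsub>L\<^esub> x = \<phi> a"
          using localization_clear_denominator[of x] Cons.prems by auto
        moreover have "\<phi> s \<in> Units L"
          using loc_map_Units \<open>s \<in> S\<close> .
        ultimately show ?case
          by (intro exI[of _ "a # as"]) force
      qed auto
      then obtain as where as: "set as \<subseteq> carrier R"
        "list_all2 (\<lambda>y x. \<exists>w\<in>Units L. y = w \<otimes>\<^bsub>L\<^esub> x) (map \<phi> as) xs" by blast
      then have "collapses R (elementary_chain R as)"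
        using assms False xs by (auto simp: krull_dim_le_def dest: list_all2_lengthD)
      then have "collapses L (elementary_chain L (map \<phi> as))"
        using collapses_image_chain[OF is_cring L.is_cring loc_map_ring_hom
            idealistic_elementary_chain[OF as(1)]]
        by (simp add: image_elementary_chain)
      then show ?thesis
        using L.collapses_elementary_chain_units as xs by blast
    qed
    then show ?thesis using False by (simp add: krull_dim_le_def)
  qed
qed

end

section \<open>Local-global principle for collapse and for Krull dimension\<close>

theorem proposition1p27:
  fixes R :: "('a, 'b) ring_scheme" and n :: nat and S :: "nat \<Rightarrow> 'a set"
  assumes "cring R"
    and "\<forall>i\<in>{1..n}. submonoid (S i) R"
    and "comaximal R n S"
  shows "(\<forall>C. idealistic_chain R C \<longrightarrow>
            (collapses R C \<longleftrightarrow>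
             (\<forall>i\<in>{1..n}. collapses (localization R (S i)) (image_chain (loc_map R (S i)) C)))) \<and>
         (\<forall>l\<ge>- 1. krull_dim_le R l \<longleftrightarrow>
             (\<forall>i\<in>{1..n}. krull_dim_le (localization R (S i)) l))"
proof -
  interpret R: cring R by fact
  have cs: "cring_submonoid R (S i)" if "i \<in> {1..n}" for i
    using assms that by (simp add: cring_submonoid_def)
  have chain: "collapses R C \<longleftrightarrow>
      (\<forall>i\<in>{1..n}. collapses (localization R (S i)) (image_chain (loc_map R (S i)) C))"
    if C: "idealistic_chain R C" for C
  proof
    assume "collapses R C"
    then show "\<forall>i\<in>{1..n}. collapses (localization R (S i)) (image_chain (loc_map R (S i)) C)"
      using collapses_image_chain[OF assms(1) _ _ C] cs
        cring_submonoid.cring_localization cring_submonoid.loc_map_ring_hom by blast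
  next
    assume "\<forall>i\<in>{1..n}. collapses (localization R (S i)) (image_chain (loc_map R (S i)) C)"
    then show "collapses R C"
      using R.collapses_comaximal[OF C assms(3)] assms(2) submonoid.subset
        cring_submonoid.collapses_localizationD[OF cs C] by blast
  qed
  have dim: "krull_dim_le R l"
    if loc: "\<forall>i\<in>{1..n}. krull_dim_le (localization R (S i)) l" for l
  proof (cases "l = -1")
    case True
    \<comment> \<open>A trivial localization means that some element of \<open>S i\<close>
      annihilates \<open>\<one>\<close>, that is, \<open>S i\<close> contains zero. The zero ideal
      then meets every monoid.\<close>
    have "{\<zero>\<^bsub>R\<^esub>} \<inter> S i \<noteq> {}" if i: "i \<in> {1..n}" for i
    proof -
      interpret cring_submonoid R "S i" using cs[OF i] .
      have "\<phi> \<one>\<^bsub>R\<^esub> = \<zero>\<^bsub>L\<^esub>"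
        using loc i True ring_hom_one[OF loc_map_ring_hom] by (simp add: krull_dim_le_def)
      then show ?thesis
        using loc_map_eq_zero[of "\<one>\<^bsub>R\<^esub>"] by force
    qed
    then have "\<one>\<^bsub>R\<^esub> \<in> {\<zero>\<^bsub>R\<^esub>}"
      using assms(3) R.zeroideal unfolding comaximal_def by blast
    then show ?thesis using True by (simp add: krull_dim_le_def)
  next
    case False
    have "collapses R (elementary_chain R xs)"
      if xs: "int (length xs) = l + 1" "set xs \<subseteq> carrier R" for xs
    proof -
      \<comment> \<open>The image of an elementary chain is the elementary chain of the image
        sequence, so the dimension bound of the localization applies to it.\<close>
      have "collapses (localization R (S i)) (image_chain (loc_map R (S i)) (elementary_chain R xs))"
        if i: "i \<in> {1..n}" for i
      proof -
        interpret cring_submonoid R "S i" using cs[OF i] .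
        interpret L: cring L by (rule cring_localization)
        interpret H: ring_hom_cring R L \<phi> by (rule loc_map_ring_hom_cring)
        have "set (map \<phi> xs) \<subseteq> carrier L"
          using xs by auto
        then have "collapses L (elementary_chain L (map \<phi> xs))"
          using loc i False xs by (simp add: krull_dim_le_def)
        then show ?thesis
          by (simp add: image_elementary_chain)
      qed
      then show ?thesis
        using chain[OF R.idealistic_elementary_chain[OF xs(2)]] by blast
    qed
    then show ?thesis using False by (simp add: krull_dim_le_def)
  qed
  show ?thesis
    using chain dim cring_submonoid.krull_dim_le_localization[OF cs] by blast
qed

end
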